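(* Let $R$ be a commutative semiring and let $S$ be a multiplicatively closed subset of $R$. If $I$ is a quasi $S$-$n$-ideal of $R$, then $\sqrt{I}$ is an $S$-$n$-ideal of $R$.
   Context: All semirings are commutative with identity $1\neq 0$. A subset $S$ of $R$ is multiplicatively closed if $0\notin S$, $1\in S$, and $st\in S$ for all $s,t\in S$. For an ideal $I$, $\sqrt{I}=\{a\in R: a^n\in I \text{ for some } n\in\mathbb{N}\}$, and $N(R)=\sqrt{(0)}$ is the nilradical. A proper ideal $I$ of $R$ with $I\cap S=\emptyset$ is a quasi $S$-$n$-ideal (resp. an $S$-$n$-ideal) of $R$ if there exists a fixed element $s\in S$ such that, for all $a,b\in R$, $ab\in I$ implies $sa^2\in I$ (resp. $sa\in I$) or $sb\in N(R)$. *)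

theory Defs imports Main begin

text \<open>
  The ambient commutative semiring is a type of class \<open>comm_semiring_1\<close>, whose axioms include
  that \<open>0\<close> is absorbing and \<open>0 \<noteq> 1\<close>. Ideals are defined here because the library's ideals live
  in rings.
\<close>

definition semiring_ideal :: "'a::comm_semiring_1 set \<Rightarrow> bool" where
  "semiring_ideal I \<longleftrightarrow>
     I \<noteq> {} \<and> (\<forall>a\<in>I. \<forall>b\<in>I. a + b \<in> I) \<and> (\<forall>r. \<forall>a\<in>I. r * a \<in> I)"

definition proper_ideal :: "'a::comm_semiring_1 set \<Rightarrow> bool" where
  "proper_ideal I \<longleftrightarrow> semiring_ideal I \<and> I \<noteq> UNIV"

definition mult_closed :: "'a::comm_semiring_1 set \<Rightarrow> bool" where
  "mult_closed S \<longleftrightarrow> 0 \<notin> S \<and> 1 \<in> S \<and> (\<forall>s\<in>S. \<forall>t\<in>S. s * t \<in> S)"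

text \<open>Exponents are positive. For an ideal, allowing the exponent \<open>0\<close> would give the same set.\<close>

definition radical :: "'a::comm_semiring_1 set \<Rightarrow> 'a set" where
  "radical I = {a. \<exists>n::nat. n \<ge> 1 \<and> a ^ n \<in> I}"

definition nilradical :: "'a::comm_semiring_1 set" where
  "nilradical = radical {0}"

text \<open>
  The \<open>n\<close> in ``\<open>S\<close>-\<open>n\<close>-ideal'' is part of the name (it refers to the nilradical), not a parameter.
  The element \<open>s\<close> is chosen once, uniformly in \<open>a\<close> and \<open>b\<close>.
\<close>

definition S_n_ideal :: "'a::comm_semiring_1 set \<Rightarrow> 'a set \<Rightarrow> bool" where
  "S_n_ideal S I \<longleftrightarrow>
     proper_ideal I \<and> I \<inter> S = {} \<and>
     (\<exists>s\<in>S. \<forall>a b. a * b \<in> I \<longrightarrow> s * a \<in> I \<or> s * b \<in> nilradical)"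

definition quasi_S_n_ideal :: "'a::comm_semiring_1 set \<Rightarrow> 'a set \<Rightarrow> bool" where
  "quasi_S_n_ideal S I \<longleftrightarrow>
     proper_ideal I \<and> I \<inter> S = {} \<and>
     (\<exists>s\<in>S. \<forall>a b. a * b \<in> I \<longrightarrow> s * a ^ 2 \<in> I \<or> s * b \<in> nilradical)"

end

theory Submission imports Defs begin

text \<open>
  If \<open>a * b\<close> lies in the radical of \<open>I\<close>, then \<open>a ^ n * b ^ n \<in> I\<close> for some \<open>n\<close>, and the quasi
  condition with witness \<open>s\<close> applies to this product. It yields \<open>s * a ^ (2 * n) \<in> I\<close> or
  \<open>s * b ^ n\<close> nilpotent. The square and the power \<open>n\<close> are both invisible to radicals: if
  \<open>s * x ^ k\<close> lies in the radical of an ideal and \<open>k \<ge> 1\<close>, then so does its multiple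
  \<open>(s * x) ^ k\<close>, hence so does \<open>s * x\<close> (\<open>radical_absorbs_power\<close>). Used for \<open>I\<close> in the first case and
  for \<open>{0}\<close> in the second, this shows that the same \<open>s\<close> witnesses the \<open>S\<close>-\<open>n\<close>-condition for the
  radical. What remains is that the radical is an ideal, which is the binomial theorem, and
  that it avoids \<open>S\<close>, since \<open>S\<close> is closed under powers.
\<close>

lemma semiring_idealD:
  assumes "semiring_ideal I"
  shows semiring_ideal_add: "a \<in> I \<Longrightarrow> b \<in> I \<Longrightarrow> a + b \<in> I"
    and semiring_ideal_mult: "a \<in> I \<Longrightarrow> r * a \<in> I"
    and semiring_ideal_zero: "0 \<in> I"
proof -
  show "a \<in> I \<Longrightarrow> b \<in> I \<Longrightarrow> a + b \<in> I" and mult: "a \<in> I \<Longrightarrow> r * a \<in> I" for a b r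
    using assms by (auto simp: semiring_ideal_def)
  obtain x where "x \<in> I"
    using assms by (auto simp: semiring_ideal_def)
  from mult[OF this, of 0] show "0 \<in> I" by simp
qed

lemma semiring_ideal_singleton_zero: "semiring_ideal {0}"
  by (simp add: semiring_ideal_def)

lemma semiring_ideal_sum:
  assumes "semiring_ideal I" and "\<And>i. i \<in> A \<Longrightarrow> f i \<in> I"
  shows "sum f A \<in> I"
  using assms(2)
  by (induction A rule: infinite_finite_induct)
     (auto intro: semiring_ideal_zero[OF assms(1)] semiring_ideal_add[OF assms(1)])

lemma semiring_ideal_power_mono:
  assumes "semiring_ideal I" "a ^ m \<in> I" "m \<le> n"
  shows "a ^ n \<in> I"
proof -
  have "a ^ n = a ^ (n - m) * a ^ m"
    using assms(3) by (simp flip: power_add)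
  then show ?thesis
    using semiring_ideal_mult[OF assms(1,2)] by simp
qed

lemma subset_radical: "I \<subseteq> radical I"
  unfolding radical_def by (auto intro: exI[of _ 1])

lemma radical_power_cancel:
  assumes "a ^ k \<in> radical I" "k \<ge> 1"
  shows "a \<in> radical I"
proof -
  obtain n where "n \<ge> 1" "a ^ (k * n) \<in> I"
    using assms(1) by (auto simp: radical_def power_mult)
  moreover have "k * n \<ge> 1"
    using assms(2) \<open>n \<ge> 1\<close> by simp
  ultimately show ?thesis
    unfolding radical_def by blast
qed

text \<open>
  In each term of the binomial expansion of \<open>(a + b) ^ (m + n)\<close>, either the exponent of \<open>a\<close> is at
  least \<open>m\<close> or the exponent of \<open>b\<close> is at least \<open>n\<close>, so every term lies in \<open>I\<close> as soon as
  \<open>a ^ m\<close> and \<open>b ^ n\<close> do.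
\<close>

lemma semiring_ideal_radical:
  assumes I: "semiring_ideal I"
  shows "semiring_ideal (radical I)"
  unfolding semiring_ideal_def
proof (intro conjI ballI allI)
  show "radical I \<noteq> {}"
    using semiring_ideal_zero[OF I] subset_radical by blast
next
  fix a b assume "a \<in> radical I" "b \<in> radical I"
  then obtain m n where m: "m \<ge> 1" "a ^ m \<in> I" and n: "n \<ge> 1" "b ^ n \<in> I"
    by (auto simp: radical_def)
  have "of_nat ((m + n) choose k) * a ^ k * b ^ (m + n - k) \<in> I" for k
  proof (cases "m \<le> k")
    case True
    from semiring_ideal_mult[OF I semiring_ideal_power_mono[OF I m(2) True],
        of "of_nat ((m + n) choose k) * b ^ (m + n - k)"]
    show ?thesis by (simp add: ac_simps)
  next
    case False
    then have "n \<le> m + n - k" by simp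
    from semiring_ideal_mult[OF I semiring_ideal_power_mono[OF I n(2) this]]
    show ?thesis .
  qed
  then have "(a + b) ^ (m + n) \<in> I"
    unfolding binomial_ring by (intro semiring_ideal_sum[OF I])
  with m(1) show "a + b \<in> radical I"
    by (auto simp: radical_def intro: exI[of _ "m + n"])
next
  fix r a assume "a \<in> radical I"
  then show "r * a \<in> radical I"
    by (auto simp: radical_def power_mult_distrib intro: semiring_ideal_mult[OF I])
qed

lemma mult_closed_power:
  assumes "mult_closed S" "a \<in> S"
  shows "a ^ n \<in> S"
  using assms by (induction n) (auto simp: mult_closed_def)

lemma radical_disjoint_mult_closed:
  assumes "mult_closed S" "I \<inter> S = {}"
  shows "radical I \<inter> S = {}"
  using assms mult_closed_power by (fastforce simp: radical_def)

text \<open>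
  The factor \<open>s\<close> is only present to the first power, but multiplying by \<open>s ^ (k - 1)\<close> turns
  \<open>s * x ^ k\<close> into the perfect power \<open>(s * x) ^ k\<close>.
\<close>

lemma radical_absorbs_power:
  assumes I: "semiring_ideal I" and "s * x ^ k \<in> radical I" and "k \<ge> 1"
  shows "s * x \<in> radical I"
proof -
  have "(s * x) ^ k = s ^ (k - 1) * (s * x ^ k)"
    using assms(3) by (cases k) (simp_all add: power_mult_distrib ac_simps)
  also have "\<dots> \<in> radical I"
    using semiring_ideal_mult[OF semiring_ideal_radical[OF I] assms(2)] .
  finally show ?thesis
    using radical_power_cancel assms(3) by blast
qed

theorem theorem2p13:
  fixes S I :: "'a::comm_semiring_1 set"
  assumes "mult_closed S"
    and "quasi_S_n_ideal S I"
  shows "S_n_ideal S (radical I)"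
proof -
  from assms(2) obtain s where I: "semiring_ideal I" and disj: "I \<inter> S = {}" and "s \<in> S"
    and s: "\<And>a b. a * b \<in> I \<Longrightarrow> s * a ^ 2 \<in> I \<or> s * b \<in> nilradical"
    by (auto simp: quasi_S_n_ideal_def proper_ideal_def)
  have disj': "radical I \<inter> S = {}"
    using radical_disjoint_mult_closed[OF assms(1) disj] .
  have "1 \<in> S"
    using assms(1) by (simp add: mult_closed_def)
  with disj' have "proper_ideal (radical I)"
    using semiring_ideal_radical[OF I] by (auto simp: proper_ideal_def)
  moreover have "s * a \<in> radical I \<or> s * b \<in> nilradical" if ab: "a * b \<in> radical I" for a b
  proof -
    obtain n where n: "n \<ge> 1" "a ^ n * b ^ n \<in> I"
      using ab by (auto simp: radical_def power_mult_distrib)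
    from s[OF n(2)] show ?thesis
    proof
      assume "s * (a ^ n) ^ 2 \<in> I"
      then have "s * a ^ (n * 2) \<in> radical I"
        using subset_radical by (auto simp: power_mult)
      then show ?thesis
        using radical_absorbs_power[OF I] n(1) by simp
    next
      assume "s * b ^ n \<in> nilradical"
      then show ?thesis
        using radical_absorbs_power[OF semiring_ideal_singleton_zero] n(1)
        by (auto simp: nilradical_def)
    qed
  qed
  ultimately show ?thesis
    using disj' \<open>s \<in> S\<close> by (auto simp: S_n_ideal_def)
qed

end
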